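(* Let $f:\mathbb{R}\to\mathbb{R}$. (a) In order for $\widehat f$ to exist at some $s\in\mathbb{R}$ it is necessary that $f\in\mathcal{HK}_{loc}$. (b) If $f\in\mathcal{HK}_{loc}$ then $\widehat f$ exists on $\mathbb{R}$ if $|f|$ is integrable in a neighbourhood of infinity or if $f$ is of bounded variation in a neighbourhood of infinity with limit $0$ at infinity. (c) Let $f\in\mathcal{HK}$. Define $F_1(x)=\int_x^\infty f$ and $F_2(x)=\int_{-\infty}^x f$. Then $\widehat f$ exists at $s\in\mathbb{R}$ if and only if both the integrals $\int_0^\infty e^{-isx}F_1(x)\,dx$ and $\int_{-\infty}^0 e^{-isx}F_2(x)\,dx$ exist.
   Context: All integrals are Henstock--Kurzweil integrals (over unbounded intervals, convergence is at $+\infty$ and $-\infty$ separately, not in the principal value sense); complex-valued functions are integrated by real and imaginary parts. $\mathcal{HK}$ is the set of Henstock--Kurzweil integrable functions on $\mathbb{R}$, and $\mathcal{HK}_{loc}$ the set of functions Henstock--Kurzweil integrable over every compact interval. The Fourier transform is $\widehat f(s)=\int_{-\infty}^\infty e^{-isx}f(x)\,dx$; it exists at $s$ if $x\mapsto e^{-isx}f(x)$ is in $\mathcal{HK}$. "In a neighbourhood of infinity" means on $(-\infty,-R]$ and on $[R,\infty)$ for some $R>0$; "limit at infinity" refers to both $x\to\infty$ and $x\to-\infty$.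
   Formalization: In (b), the bounded variation case gives existence only for s≠0 (1/max(1,|x|) fails at s=0); in (c), the equivalence is for s≠0, and at s=0 only "if" is kept ("only if" fails for f=x^-2 on [1,∞), 0 elsewhere). *)

theory Defs
  imports "HOL-Analysis.Analysis"
begin

text \<open>
  The integral of \<^theory>\<open>HOL-Analysis.Henstock_Kurzweil_Integration\<close> is the Henstock--Kurzweil
  integral. Over an unbounded interval it is the limit of the integrals over \<open>{a..b}\<close> of the
  integrand extended by zero, where \<open>{a..b}\<close> only has to contain large balls: the two ends tend to
  infinity independently, so this is not a principal value. Since convergence in \<^typ>\<open>complex\<close>
  is convergence of real and imaginary parts, a complex-valued function is integrable iff both
  parts are.
\<close>

definition HK :: "(real \<Rightarrow> real) set" where
  "HK = {f. f integrable_on UNIV}"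

definition HK_loc :: "(real \<Rightarrow> real) set" where
  "HK_loc = {f. \<forall>a b. f integrable_on {a..b}}"

definition fourier_kernel :: "real \<Rightarrow> real \<Rightarrow> complex" where
  "fourier_kernel s x = exp (- (\<i> * complex_of_real s * complex_of_real x))"

definition fourier_exists_at :: "(real \<Rightarrow> real) \<Rightarrow> real \<Rightarrow> bool" where
  "fourier_exists_at f s \<longleftrightarrow> (\<lambda>x. fourier_kernel s x * complex_of_real (f x)) integrable_on UNIV"

definition bounded_variation_on :: "(real \<Rightarrow> real) \<Rightarrow> real set \<Rightarrow> bool" where
  "bounded_variation_on f S \<longleftrightarrow>
     (\<exists>B. \<forall>n (x :: nat \<Rightarrow> real). (\<forall>i\<le>n. x i \<in> S) \<and> (\<forall>i<n. x i \<le> x (Suc i)) \<longrightarrow>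
        (\<Sum>i<n. \<bar>f (x (Suc i)) - f (x i)\<bar>) \<le> B)"

definition abs_integrable_near_infinity :: "(real \<Rightarrow> real) \<Rightarrow> bool" where
  "abs_integrable_near_infinity f \<longleftrightarrow>
     (\<exists>R>0. (\<lambda>x. \<bar>f x\<bar>) integrable_on {..-R} \<and> (\<lambda>x. \<bar>f x\<bar>) integrable_on {R..})"

definition bounded_variation_near_infinity :: "(real \<Rightarrow> real) \<Rightarrow> bool" where
  "bounded_variation_near_infinity f \<longleftrightarrow>
     (\<exists>R>0. bounded_variation_on f {..-R} \<and> bounded_variation_on f {R..})"

definition right_tail :: "(real \<Rightarrow> real) \<Rightarrow> real \<Rightarrow> real" where
  "right_tail f x = integral {x..} f"

definition left_tail :: "(real \<Rightarrow> real) \<Rightarrow> real \<Rightarrow> real" where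
  "left_tail f x = integral {..x} f"

text \<open>
  The frequency \<open>s = 0\<close> is exceptional. There \<open>fourier_exists_at f 0\<close> just says \<open>f \<in> HK\<close>, which
  neither follows from bounded variation with limit \<open>0\<close> (take \<open>1 / max 1 \<bar>x\<bar>\<close>) nor implies that
  the tails are integrable (take \<open>1 / x\<^sup>2\<close> on \<open>{1..}\<close> and \<open>0\<close> elsewhere).
\<close>

definition tail_transforms_exist_at :: "(real \<Rightarrow> real) \<Rightarrow> real \<Rightarrow> bool" where
  "tail_transforms_exist_at f s \<longleftrightarrow>
     (\<lambda>x. fourier_kernel s x * complex_of_real (right_tail f x)) integrable_on {0..} \<and>
     (\<lambda>x. fourier_kernel s x * complex_of_real (left_tail f x)) integrable_on {..0}"

end

theory Submission
  imports Defs
begin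

text \<open>
  The kernel is \<open>cos (s x) - \<i> sin (s x)\<close>, so \<open>e\<^sup>-\<^sup>i\<^sup>s\<^sup>x f\<close> is integrable iff the real functions
  \<open>cos (s x) f\<close> and \<open>sin (s x) f\<close> are (\<open>fourier_integrable_iff\<close>). Everything then rests on
  multiplying a Henstock--Kurzweil integrable function, whose primitive need not be differentiable
  everywhere, by a \<open>C\<^sup>1\<close> function \<open>h\<close>. On a compact interval the product is integrable and
  integration by parts holds (\<open>has_integral_by_parts\<close>).

  \<^item> Since \<open>f = cos (s x) (cos (s x) f) + sin (s x) (sin (s x) f)\<close>, local integrability of the two
    products gives that of \<open>f\<close>. Conversely, if \<open>f\<close> is locally integrable then so are the products,
    and only the behaviour on \<open>{R..}\<close> and, after a reflection, on \<open>{..-R}\<close> remains to be studied.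

  \<^item> If \<open>\<bar>f\<bar>\<close> is integrable on a half-line, it dominates the products there. If \<open>f\<close> has bounded
    variation and tends to \<open>0\<close>, it is a difference of two decreasing functions that tend to \<open>0\<close>,
    and for \<open>s \<noteq> 0\<close> the integrals of \<open>cos (s x)\<close> and \<open>sin (s x)\<close> are bounded, so Dirichlet's test
    applies (\<open>Dirichlet_test_bounded_variation\<close>).

  \<^item> Write \<open>T x\<close> for the integral of \<open>f\<close> over \<open>{x..}\<close>, so that \<open>-T\<close> is a primitive of \<open>f\<close> that
    vanishes at infinity. For bounded \<open>h\<close> the boundary term in the integration by parts converges,
    hence \<open>h f\<close> is integrable on a half-line iff \<open>h' T\<close> is (\<open>integrable_on_atLeast_by_parts\<close>). For
    \<open>h = cos (s x)\<close> and \<open>h = sin (s x)\<close> with \<open>s \<noteq> 0\<close> the function \<open>h'\<close> is a nonzero multiple of the other one,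
    and the two equivalences together are the one between the transforms of \<open>f\<close> and of its tails.
\<close>

section \<open>Integration by parts on a compact interval\<close>

text \<open>
  The second mean value theorem read as an integration by parts: in the remaining integral of \<open>F\<close>
  against the increments of \<open>h\<close>, the primitive \<open>F\<close> of \<open>f\<close> is frozen at an intermediate point.
\<close>

lemma second_mean_value_primitive:
  fixes f F h :: "real \<Rightarrow> real"
  assumes f: "f integrable_on {a..b}" and "a \<le> b"
    and F: "\<And>x. x \<in> {a..b} \<Longrightarrow> F x = F a + integral {a..x} f"
    and h: "\<And>x y. a \<le> x \<Longrightarrow> x \<le> y \<Longrightarrow> y \<le> b \<Longrightarrow> h x \<le> h y"
  obtains c where "c \<in> {a..b}"
    and "((\<lambda>x. h x * f x) has_integral (h b * F b - h a * F a - F c * (h b - h a))) {a..b}"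
proof -
  obtain c where c: "c \<in> {a..b}"
    and I: "((\<lambda>x. h x * f x) has_integral (h a * integral {a..c} f + h b * integral {c..b} f)) {a..b}"
    using second_mean_value_theorem_full[OF f \<open>a \<le> b\<close> h] .
  have "integral {a..c} f + integral {c..b} f = integral {a..b} f"
    using c f by (intro Henstock_Kurzweil_Integration.integral_combine) auto
  then have "integral {a..c} f = F c - F a" "integral {c..b} f = F b - F c"
    using F[OF c] F[of b] \<open>a \<le> b\<close> by auto
  with I c that show ?thesis by (simp add: algebra_simps)
qed

text \<open>
  Up to the constant \<open>h a * F a\<close>, the number \<open>D x\<close> is the difference of the two sides on \<open>{a..x}\<close>.
  It takes the same value at \<open>a\<close> and \<open>b\<close>: by the second mean value theorem, its increment on
  \<open>{x..y}\<close> is the integral of \<open>h' (F - F c)\<close> over \<open>{x..y}\<close> for some \<open>c\<close> in there, hence at most the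
  oscillation of \<open>F\<close> on \<open>{x..y}\<close> times \<open>h y - h x\<close>. As \<open>F\<close> is uniformly continuous, adding this up
  over a fine partition gives at most \<open>e (h b - h a)\<close>, for every \<open>e > 0\<close>.
\<close>

lemma has_integral_by_parts_mono:
  fixes f F h h' :: "real \<Rightarrow> real"
  assumes f: "f integrable_on {a..b}" and ab: "a \<le> b"
    and F: "\<And>x. x \<in> {a..b} \<Longrightarrow> F x = F a + integral {a..x} f"
    and h: "\<And>x. x \<in> {a..b} \<Longrightarrow> (h has_real_derivative h' x) (at x within {a..b})"
    and cont: "continuous_on {a..b} h'"
    and pos: "\<And>x. x \<in> {a..b} \<Longrightarrow> 0 \<le> h' x"
  shows "((\<lambda>x. h x * f x) has_integral
    (h b * F b - h a * F a - integral {a..b} (\<lambda>x. h' x * F x))) {a..b}"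
proof -
  have contF: "continuous_on {a..b} F"
    by (subst continuous_on_cong[OF refl F])
      (auto intro!: continuous_intros indefinite_integral_continuous_1 f)
  have int_hF: "(\<lambda>x. h' x * F x) integrable_on {x..y}" if "a \<le> x" "y \<le> b" for x y
    using that by (intro integrable_continuous_interval continuous_intros
        continuous_on_subset[OF cont] continuous_on_subset[OF contF]) auto
  have int_h: "(h' has_integral (h y - h x)) {x..y}" if "a \<le> x" "x \<le> y" "y \<le> b" for x y
    using that by (intro fundamental_theorem_of_calculus)
      (auto simp: has_real_derivative_iff_has_vector_derivative[symmetric]
        intro!: DERIV_subset[OF h])
  have mono: "h x \<le> h y" if "a \<le> x" "x \<le> y" "y \<le> b" for x y
    using has_integral_nonneg[OF int_h[OF that]] pos that by simp
  have sub: "f integrable_on {x..y}" if "a \<le> x" "y \<le> b" for x y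
    using f by (rule integrable_subinterval_real) (use that in auto)
  have Fxy: "F z = F x + integral {x..z} f" if "a \<le> x" "x \<le> z" "z \<le> b" for x z
    using Henstock_Kurzweil_Integration.integral_combine[of a x z f] sub[of a z] F[of x] F[of z] that by auto
  have local_mono: "\<exists>c\<in>{x..y}. ((\<lambda>t. h t * f t) has_integral (h y * F y - h x * F x - F c * (h y - h x))) {x..y}"
    if "a \<le> x" "x \<le> y" "y \<le> b" for x y
  proof (rule second_mean_value_primitive[OF sub \<open>x \<le> y\<close>, of F h])
    show "F z = F x + integral {x..z} f" if "z \<in> {x..y}" for z
      using Fxy[of x z] \<open>a \<le> x\<close> \<open>y \<le> b\<close> that by auto
  qed (use that mono in auto)
  have int_hf: "(\<lambda>t. h t * f t) integrable_on {x..y}" if "a \<le> x" "x \<le> y" "y \<le> b" for x y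
    using local_mono[OF that] by blast
  define D where "D x = integral {a..x} (\<lambda>t. h t * f t) - h x * F x + integral {a..x} (\<lambda>t. h' t * F t)" for x
  have D_diff: "\<bar>D y - D x\<bar> \<le> e * (h y - h x)"
    if xy: "a \<le> x" "x \<le> y" "y \<le> b" and e: "\<And>u v. u \<in> {x..y} \<Longrightarrow> v \<in> {x..y} \<Longrightarrow> \<bar>F u - F v\<bar> \<le> e" for x y e
  proof -
    obtain c where c: "c \<in> {x..y}"
      and I: "integral {x..y} (\<lambda>t. h t * f t) = h y * F y - h x * F x - F c * (h y - h x)"
      using local_mono[OF xy] by (metis integral_unique)
    have 1: "integral {a..x} (\<lambda>t. h t * f t) + integral {x..y} (\<lambda>t. h t * f t) = integral {a..y} (\<lambda>t. h t * f t)"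
      using xy by (intro Henstock_Kurzweil_Integration.integral_combine int_hf) auto
    have 2: "integral {a..x} (\<lambda>t. h' t * F t) + integral {x..y} (\<lambda>t. h' t * F t) = integral {a..y} (\<lambda>t. h' t * F t)"
      using xy by (intro Henstock_Kurzweil_Integration.integral_combine int_hF) auto
    have 3: "((\<lambda>t. h' t * (F t - F c)) has_integral (integral {x..y} (\<lambda>t. h' t * F t) - (h y - h x) * F c)) {x..y}"
      using has_integral_diff[OF integrable_integral[OF int_hF[of x y]] has_integral_mult_left[OF int_h[of x y], of "F c"]] xy
      by (simp add: algebra_simps)
    have "D y - D x = integral {x..y} (\<lambda>t. h' t * F t) - (h y - h x) * F c"
      using 1 2 I by (simp add: D_def algebra_simps)
    also have "\<dots> = integral {x..y} (\<lambda>t. h' t * (F t - F c))"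
      using 3 by (simp add: integral_unique)
    also have "\<bar>\<dots>\<bar> \<le> integral {x..y} (\<lambda>t. h' t * e)"
    proof -
      have "norm (integral {x..y} (\<lambda>t. h' t * (F t - F c))) \<le> integral {x..y} (\<lambda>t. h' t * e)"
      proof (rule integral_norm_bound_integral)
        show "(\<lambda>t. h' t * (F t - F c)) integrable_on {x..y}" using 3 by blast
        show "(\<lambda>t. h' t * e) integrable_on {x..y}"
          using has_integral_mult_left[OF int_h[of x y], of e] xy by blast
        show "norm (h' t * (F t - F c)) \<le> h' t * e" if "t \<in> {x..y}" for t
          using e[OF that c] pos[of t] xy that by (simp add: abs_mult mult_left_mono)
      qed
      then show ?thesis by simp
    qed
    also have "\<dots> = e * (h y - h x)"
      using has_integral_mult_left[OF int_h[of x y], of e] xy by (metis integral_unique mult.commute)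
    finally show ?thesis .
  qed
  have "D b = D a"
  proof (cases "a = b")
    case False
    have "uniformly_continuous_on {a..b} F"
      using contF by (rule compact_uniformly_continuous) simp
    show ?thesis
    proof (rule ccontr)
      assume "D b \<noteq> D a"
      \<comment> \<open>chosen such that \<open>e * (h b - h a) < \<bar>D b - D a\<bar>\<close>; the summand \<open>1\<close> allows \<open>h b = h a\<close>\<close>
      define e where "e = \<bar>D b - D a\<bar> / (2 * (h b - h a + 1))"
      have hab: "h b - h a \<ge> 0" using mono[of a b] ab by simp
      then have e: "e > 0" using \<open>D b \<noteq> D a\<close> by (simp add: e_def)
      obtain d where d: "d > 0" and dF: "\<And>u v. u \<in> {a..b} \<Longrightarrow> v \<in> {a..b} \<Longrightarrow> \<bar>u - v\<bar> < d \<Longrightarrow> \<bar>F u - F v\<bar> < e"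
        using \<open>uniformly_continuous_on {a..b} F\<close> e unfolding uniformly_continuous_on_def dist_real_def
        by metis
      obtain n :: nat where n: "(b - a) / d < real n"
        using reals_Archimedean2 by blast
      have n0: "0 < real n" using n d ab by (meson divide_nonneg_pos diff_ge_0_iff_ge le_less_trans)
      define p where "p i = a + (b - a) * real i / real n" for i :: nat
      have p_ends: "p 0 = a" "p n = b" using n0 by (simp_all add: p_def)
      have p: "p (Suc i) - p i < d" "p i \<le> p (Suc i)" for i
      proof -
        have "p (Suc i) - p i = (b - a) / n" by (simp add: p_def algebra_simps add_divide_distrib diff_divide_distrib)
        also have "\<dots> < d" using n n0 d by (simp add: field_simps)
        finally show "p (Suc i) - p i < d" .
        show "p i \<le> p (Suc i)" using ab n0 by (simp add: p_def divide_right_mono mult_left_mono)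
      qed
      have p_in: "a \<le> p i" "p i \<le> b" if "i \<le> n" for i
      proof -
        show "a \<le> p i" using ab n0 by (simp add: p_def)
        have "(b - a) * (real i / real n) \<le> (b - a) * 1"
          using that n0 ab by (intro mult_left_mono) (simp_all add: divide_le_eq_1)
        then show "p i \<le> b" by (simp add: p_def)
      qed
      have "D b - D a = (\<Sum>i<n. D (p (Suc i)) - D (p i))"
        by (simp add: sum_lessThan_telescope[of "\<lambda>i. D (p i)"] p_ends)
      also have "\<bar>\<dots>\<bar> \<le> (\<Sum>i<n. \<bar>D (p (Suc i)) - D (p i)\<bar>)" by (rule sum_abs)
      also have "\<dots> \<le> (\<Sum>i<n. e * (h (p (Suc i)) - h (p i)))"
      proof (rule sum_mono)
        fix i assume i: "i \<in> {..<n}"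
        show "\<bar>D (p (Suc i)) - D (p i)\<bar> \<le> e * (h (p (Suc i)) - h (p i))"
        proof (rule D_diff)
          show "a \<le> p i" "p i \<le> p (Suc i)" "p (Suc i) \<le> b"
            using p p_in i by auto
          fix u v assume "u \<in> {p i..p (Suc i)}" "v \<in> {p i..p (Suc i)}"
          then have "\<bar>F u - F v\<bar> < e"
            using p(1)[of i] p_in[of i] p_in[of "Suc i"] i by (intro dF) auto
          then show "\<bar>F u - F v\<bar> \<le> e" by simp
        qed
      qed
      also have "\<dots> = e * (h b - h a)"
        by (simp add: sum_distrib_left[symmetric] sum_lessThan_telescope[of "\<lambda>i. h (p i)"] p_ends)
      also have "\<dots> < e * (2 * (h b - h a + 1))"
        using e hab by (intro mult_strict_left_mono) auto
      also have "\<dots> = \<bar>D b - D a\<bar>"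
        using hab by (simp add: e_def)
      finally show False by simp
    qed
  qed simp
  then have "integral {a..b} (\<lambda>t. h t * f t) = h b * F b - h a * F a - integral {a..b} (\<lambda>x. h' x * F x)"
    by (simp add: D_def)
  then show ?thesis
    using int_hf[of a b] ab by (metis integrable_integral order_refl)
qed

text \<open>
  With a bound \<open>L\<close> for \<open>\<bar>h'\<bar>\<close>, both \<open>h x + L x\<close> and \<open>L x\<close> are increasing, and the formula is linear in
  the factor.
\<close>

lemma has_integral_by_parts:
  fixes f F h h' :: "real \<Rightarrow> real"
  assumes f: "f integrable_on {a..b}" and ab: "a \<le> b"
    and F: "\<And>x. x \<in> {a..b} \<Longrightarrow> F x = F a + integral {a..x} f"
    and h: "\<And>x. x \<in> {a..b} \<Longrightarrow> (h has_real_derivative h' x) (at x within {a..b})"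
    and cont: "continuous_on {a..b} h'"
  shows "((\<lambda>x. h x * f x) has_integral
    (h b * F b - h a * F a - integral {a..b} (\<lambda>x. h' x * F x))) {a..b}"
proof -
  have "bounded (h' ` {a..b})"
    using cont by (intro compact_imp_bounded compact_continuous_image) auto
  then obtain L where L: "\<And>x. x \<in> {a..b} \<Longrightarrow> \<bar>h' x\<bar> \<le> L" and "L > 0"
    unfolding bounded_pos by (metis imageI real_norm_def)
  have pos: "0 \<le> h' x + L" if "x \<in> {a..b}" for x
    using L[OF that] by linarith
  have contF: "continuous_on {a..b} F"
    by (subst continuous_on_cong[OF refl F])
      (auto intro!: continuous_intros indefinite_integral_continuous_1 f)
  have 1: "(\<lambda>x. h' x * F x) integrable_on {a..b}"
    by (intro integrable_continuous_interval continuous_intros cont contF)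
  have 2: "(\<lambda>x. L * F x) integrable_on {a..b}"
    by (intro integrable_continuous_interval continuous_intros contF)
  have I: "((\<lambda>x. (h x + L * x) * f x) has_integral
    ((h b + L * b) * F b - (h a + L * a) * F a - integral {a..b} (\<lambda>x. (h' x + L) * F x))) {a..b}"
    using pos by (intro has_integral_by_parts_mono[OF f ab F])
      (auto intro!: derivative_eq_intros h continuous_intros cont)
  have J: "((\<lambda>x. (L * x) * f x) has_integral
    ((L * b) * F b - (L * a) * F a - integral {a..b} (\<lambda>x. L * F x))) {a..b}"
    using \<open>L > 0\<close> by (intro has_integral_by_parts_mono[OF f ab F])
      (auto intro!: derivative_eq_intros continuous_intros)
  have K: "integral {a..b} (\<lambda>x. (h' x + L) * F x) = integral {a..b} (\<lambda>x. h' x * F x) + integral {a..b} (\<lambda>x. L * F x)"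
    using integral_add[OF 1 2] by (simp add: distrib_right)
  show ?thesis
    using has_integral_diff[OF I J] unfolding K by (simp add: algebra_simps)
qed

lemma integrable_on_mult_C1:
  fixes f h h' :: "real \<Rightarrow> real"
  assumes f: "f integrable_on {a..b}"
    and h: "\<And>x. x \<in> {a..b} \<Longrightarrow> (h has_real_derivative h' x) (at x within {a..b})"
    and cont: "continuous_on {a..b} h'"
  shows "(\<lambda>x. h x * f x) integrable_on {a..b}"
proof (cases "a \<le> b")
  case True
  show ?thesis
    by (rule has_integral_integrable[OF has_integral_by_parts[OF f True _ h cont, of "\<lambda>x. integral {a..x} f"]])
      simp_all
qed (simp add: integrable_on_empty)

lemma integrable_on_mult_cos_sin:
  fixes f :: "real \<Rightarrow> real"
  assumes "f integrable_on {a..b}"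
  shows "(\<lambda>x. cos (s * x) * f x) integrable_on {a..b}"
    and "(\<lambda>x. sin (s * x) * f x) integrable_on {a..b}"
  by (rule integrable_on_mult_C1[OF assms, where h' = "\<lambda>x. - (s * sin (s * x))"],
      auto intro!: derivative_eq_intros continuous_intros)
    (rule integrable_on_mult_C1[OF assms, where h' = "\<lambda>x. s * cos (s * x)"],
      auto intro!: derivative_eq_intros continuous_intros)

section \<open>Integrals over half-lines\<close>

lemma integrable_atLeast_restrict_iff:
  fixes f :: "real \<Rightarrow> 'a::banach"
  shows "(\<lambda>x. if x \<in> {a..} then f x else 0) integrable_on {c..d} \<longleftrightarrow> f integrable_on {max a c..d}"
proof -
  have "{a..} \<inter> {c..d} = {max a c..d}" by auto
  then show ?thesis by (simp only: integrable_restrict_Int)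
qed

lemma integral_atLeast_restrict:
  fixes f :: "real \<Rightarrow> 'a::banach"
  assumes "c \<le> a"
  shows "integral {c..d} (\<lambda>x. if x \<in> {a..} then f x else 0) = integral {a..d} f"
proof -
  have "{a..} \<inter> {c..d} = {a..d}" using assms by auto
  then show ?thesis by (simp only: integral_restrict_Int)
qed

lemma ball_0_subset_Icc_iff:
  fixes B c d :: real
  assumes "B > 0"
  shows "ball 0 B \<subseteq> {c..d} \<longleftrightarrow> c \<le> -B \<and> B \<le> d"
  using assms by (simp add: ball_eq_greaterThanLessThan greaterThanLessThan_subseteq_atLeastAtMost_iff)

text \<open>
  A compact interval that contains a large ball around \<open>0\<close> meets \<open>{a..}\<close> in some \<open>{a..b}\<close> with \<open>b\<close>
  large, so the integral over the half-line is exactly a limit of integrals over \<open>{a..b}\<close>.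
\<close>

lemma has_integral_atLeast_iff:
  fixes f :: "real \<Rightarrow> 'a::banach"
  shows "(f has_integral l) {a..} \<longleftrightarrow>
    (\<forall>b. f integrable_on {a..b}) \<and> ((\<lambda>b. integral {a..b} f) \<longlongrightarrow> l) at_top"
proof -
  let ?g = "\<lambda>x. if x \<in> {a..} then f x else 0"
  note int = integrable_atLeast_restrict_iff[of a f]
  note val = integral_atLeast_restrict[of _ a _ f]
  note ball = ball_0_subset_Icc_iff
  show ?thesis
  proof
    assume L: "(f has_integral l) {a..}"
    then have i: "\<And>c d. ?g integrable_on {c..d}"
      and lim: "\<And>e. e > 0 \<Longrightarrow> \<exists>B>0. \<forall>c d. ball 0 B \<subseteq> {c..d} \<longrightarrow> norm (integral {c..d} ?g - l) < e"
      unfolding has_integral_alt' box_real by auto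
    show "(\<forall>b. f integrable_on {a..b}) \<and> ((\<lambda>b. integral {a..b} f) \<longlongrightarrow> l) at_top"
    proof
      show "\<forall>b. f integrable_on {a..b}" using i[of a] unfolding int by simp
      show "((\<lambda>b. integral {a..b} f) \<longlongrightarrow> l) at_top"
      proof (rule tendstoI)
        fix e :: real assume "e > 0"
        then obtain B where B: "B > 0" "\<And>c d. c \<le> -B \<Longrightarrow> B \<le> d \<Longrightarrow> norm (integral {c..d} ?g - l) < e"
          using lim ball by meson
        have "dist (integral {a..d} f) l < e" if "d \<ge> B" for d
          using B(2)[of "min a (-B)" d] val[of "min a (-B)" d] that by (simp add: dist_norm)
        then show "\<forall>\<^sub>F d in at_top. dist (integral {a..d} f) l < e"
          using eventually_at_top_linorder by blast
      qed
    qed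
  next
    assume R: "(\<forall>b. f integrable_on {a..b}) \<and> ((\<lambda>b. integral {a..b} f) \<longlongrightarrow> l) at_top"
    show "(f has_integral l) {a..}"
      unfolding has_integral_alt' box_real
    proof (intro conjI allI impI)
      show "?g integrable_on {c..d}" for c d
        unfolding int using R integrable_subinterval_real[of f a d "max a c" d] by auto
      fix e :: real assume "e > 0"
      then have "\<forall>\<^sub>F d in at_top. dist (integral {a..d} f) l < e"
        using R tendstoD by blast
      then obtain N where N: "\<And>d. d \<ge> N \<Longrightarrow> dist (integral {a..d} f) l < e"
        by (auto simp: eventually_at_top_linorder)
      have "norm (integral {c..d} ?g - l) < e" if "ball 0 (\<bar>N\<bar> + \<bar>a\<bar> + 1) \<subseteq> {c..d}" for c d
      proof -
        have "c \<le> a" "N \<le> d" using that by (auto simp: ball)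
        then show ?thesis using N val by (simp add: dist_norm)
      qed
      then show "\<exists>B>0. \<forall>c d. ball 0 B \<subseteq> {c..d} \<longrightarrow> norm (integral {c..d} ?g - l) < e"
        by (intro exI[of _ "\<bar>N\<bar> + \<bar>a\<bar> + 1"]) auto
    qed
  qed
qed

lemma integrable_on_atLeast_Cauchy:
  fixes f :: "real \<Rightarrow> 'a::banach"
  assumes f: "\<And>b. f integrable_on {a..b}"
    and Cauchy: "\<And>e. e > 0 \<Longrightarrow> \<exists>N. \<forall>x\<ge>N. \<forall>y\<ge>x. norm (integral {x..y} f) < e"
  shows "f integrable_on {a..}"
proof -
  let ?g = "\<lambda>x. if x \<in> {a..} then f x else 0"
  show ?thesis
  proof (subst integrable_alt_subset, unfold box_real, intro conjI allI impI)
    show "?g integrable_on {c..d}" for c d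
      unfolding integrable_atLeast_restrict_iff
      by (rule integrable_subinterval_real[OF f[of d]]) auto
    fix e :: real assume "e > 0"
    then obtain N where N: "\<And>x y. x \<ge> N \<Longrightarrow> y \<ge> x \<Longrightarrow> norm (integral {x..y} f) < e"
      using Cauchy by blast
    define B where "B = \<bar>N\<bar> + \<bar>a\<bar> + 1"
    have B: "B > 0" unfolding B_def by linarith
    have "norm (integral {c..d} ?g - integral {c'..d'} ?g) < e"
      if "ball 0 B \<subseteq> {c..d} \<and> {c..d} \<subseteq> {c'..d'}" for c d c' d'
    proof -
      have ord: "c \<le> a" "c' \<le> a" "a \<le> d" "N \<le> d" "d \<le> d'"
        using that B ball_0_subset_Icc_iff[of B c d] by (auto simp: B_def)
      have "integral {a..d} f + integral {d..d'} f = integral {a..d'} f"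
        using ord f by (intro Henstock_Kurzweil_Integration.integral_combine) auto
      then have "integral {c..d} ?g - integral {c'..d'} ?g = - integral {d..d'} f"
        using ord by (simp only: integral_atLeast_restrict) (simp add: algebra_simps)
      then show ?thesis using N[of d d'] ord by (simp only: norm_minus_cancel)
    qed
    then show "\<exists>B>0. \<forall>c d c' d'. ball 0 B \<subseteq> {c..d} \<and> {c..d} \<subseteq> {c'..d'} \<longrightarrow>
        norm (integral {c..d} ?g - integral {c'..d'} ?g) < e"
      by (intro exI[of _ B] conjI B) blast
  qed
qed

lemma has_integral_atLeast_tail:
  fixes f :: "real \<Rightarrow> 'a::banach"
  assumes f: "f integrable_on {a..}" and "a \<le> b"
  shows "(f has_integral (integral {a..} f - integral {a..b} f)) {b..}"
proof -
  have loc: "\<And>x. f integrable_on {a..x}"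
    and lim: "((\<lambda>x. integral {a..x} f) \<longlongrightarrow> integral {a..} f) at_top"
    using integrable_integral[OF f] unfolding has_integral_atLeast_iff by auto
  have "((\<lambda>x. integral {b..x} f) \<longlongrightarrow> integral {a..} f - integral {a..b} f) at_top"
  proof (rule Lim_transform_eventually)
    show "((\<lambda>x. integral {a..x} f - integral {a..b} f) \<longlongrightarrow> integral {a..} f - integral {a..b} f) at_top"
      by (intro tendsto_intros lim)
    have "integral {a..b} f + integral {b..x} f = integral {a..x} f" if "x \<ge> b" for x
      using that \<open>a \<le> b\<close> loc by (intro Henstock_Kurzweil_Integration.integral_combine) auto
    then show "\<forall>\<^sub>F x in at_top. integral {a..x} f - integral {a..b} f = integral {b..x} f"
      by (intro eventually_at_top_linorderI[of b]) (metis add_diff_cancel_left')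
  qed
  moreover have "f integrable_on {b..x}" for x
    using loc by (rule integrable_subinterval_real) (use \<open>a \<le> b\<close> in auto)
  ultimately show ?thesis by (simp add: has_integral_atLeast_iff)
qed

text \<open>
  A conditionally convergent integral need not exist over every measurable subset, but it does over
  a half-line: an integral over \<open>{x..y}\<close> is the difference of those over \<open>{-B..y}\<close> and \<open>{-B..x}\<close>, which
  are both close to the integral over the line.
\<close>

lemma integrable_on_UNIV_imp_atLeast:
  fixes f :: "real \<Rightarrow> 'a::banach"
  assumes f: "f integrable_on UNIV"
  shows "f integrable_on {a..}"
proof (rule integrable_on_atLeast_Cauchy)
  show loc: "f integrable_on {c..d}" for c d
    using f by (rule integrable_on_subinterval) auto
  fix e :: real assume "e > 0"
  then have "\<exists>B>0. \<forall>c d c' d'. ball 0 B \<subseteq> {c..d} \<and> ball 0 B \<subseteq> {c'..d'} \<longrightarrow>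
      norm (integral {c..d} f - integral {c'..d'} f) < e"
    using integrable_altD(2)[OF f \<open>e > 0\<close>] by (simp only: box_real UNIV_I if_True)
  then obtain B where B: "B > 0"
    and small: "\<And>c d c' d'. ball 0 B \<subseteq> {c..d} \<Longrightarrow> ball 0 B \<subseteq> {c'..d'} \<Longrightarrow>
        norm (integral {c..d} f - integral {c'..d'} f) < e"
    by blast
  have "norm (integral {x..y} f) < e" if "x \<ge> B" "y \<ge> x" for x y
  proof -
    have "integral {-B..x} f + integral {x..y} f = integral {-B..y} f"
      using that B loc by (intro Henstock_Kurzweil_Integration.integral_combine) auto
    then have "integral {x..y} f = integral {-B..y} f - integral {-B..x} f"
      by (simp add: eq_diff_eq add.commute)
    moreover have "norm (integral {-B..y} f - integral {-B..x} f) < e"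
      by (rule small) (use that B in \<open>simp_all add: ball_0_subset_Icc_iff\<close>)
    ultimately show ?thesis by (simp only:)
  qed
  then show "\<exists>N. \<forall>x\<ge>N. \<forall>y\<ge>x. norm (integral {x..y} f) < e"
    by blast
qed

lemma has_integral_reflect_UNIV:
  fixes f :: "real \<Rightarrow> 'a::banach"
  assumes "(f has_integral i) UNIV"
  shows "((\<lambda>x. f (- x)) has_integral i) UNIV"
proof -
  have f: "f integrable_on {c..d}" for c d
    by (rule integrable_on_subinterval[OF has_integral_integrable[OF assms]]) simp
  have swap: "((\<lambda>x. f (- x)) has_integral integral {- d..- c} f) {c..d}" for c d
    using has_integral_reflect_real[of f _ "- c" "- d"] integrable_integral[OF f[of "- d" "- c"]] by simp
  have int: "(\<lambda>x. f (- x)) integrable_on {c..d}" for c d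
    using swap by (rule has_integral_integrable)
  have "\<exists>B>0. \<forall>c d. ball 0 B \<subseteq> {c..d} \<longrightarrow> norm (integral {c..d} (\<lambda>x. f (- x)) - i) < e"
    if "e > 0" for e
  proof -
  have "\<exists>B>0. \<forall>c d. ball 0 B \<subseteq> {c..d} \<longrightarrow> norm (integral {c..d} f - i) < e"
    using assms \<open>e > 0\<close> unfolding has_integral_alt' box_real by (simp only: UNIV_I if_True)
  then obtain B where B: "B > 0"
    and small: "\<And>c d. ball 0 B \<subseteq> {c..d} \<Longrightarrow> norm (integral {c..d} f - i) < e"
    by blast
  have "norm (integral {c..d} (\<lambda>x. f (- x)) - i) < e" if "ball 0 B \<subseteq> {c..d}" for c d
    using small[of "- d" "- c"] that swap[of d c] B
    by (simp add: ball_0_subset_Icc_iff integral_unique)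
  with B show "\<exists>B>0. \<forall>c d. ball 0 B \<subseteq> {c..d} \<longrightarrow> norm (integral {c..d} (\<lambda>x. f (- x)) - i) < e"
    by (intro exI[of _ B]) simp
  qed
  with int show ?thesis
    unfolding has_integral_alt' box_real by (simp only: UNIV_I if_True) blast
qed

lemma has_integral_reflect_atMost:
  fixes f :: "real \<Rightarrow> 'a::banach"
  shows "((\<lambda>x. f (- x)) has_integral i) {- a..} \<longleftrightarrow> (f has_integral i) {..a}"
proof -
  let ?g = "\<lambda>x. if x \<in> {..a} then f x else 0"
  have "((\<lambda>x. ?g (- x)) has_integral i) UNIV \<longleftrightarrow> (?g has_integral i) UNIV"
    using has_integral_reflect_UNIV[of ?g i] has_integral_reflect_UNIV[of "\<lambda>x. ?g (- x)" i]
    unfolding minus_minus by blast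
  moreover have "(\<lambda>x. ?g (- x)) = (\<lambda>x. if x \<in> {- a..} then f (- x) else 0)"
    by (auto simp: fun_eq_iff)
  ultimately show ?thesis by (simp only: has_integral_restrict_UNIV)
qed

lemma integrable_on_UNIV_iff_tails:
  fixes f :: "real \<Rightarrow> 'a::banach"
  assumes "a \<le> b" and ab: "f integrable_on {a..b}"
  shows "f integrable_on UNIV \<longleftrightarrow> f integrable_on {..a} \<and> f integrable_on {b..}"
proof
  assume f: "f integrable_on UNIV"
  then have "(\<lambda>x. f (- x)) integrable_on {- a..}"
    using has_integral_reflect_UNIV by (blast intro: integrable_on_UNIV_imp_atLeast)
  then show "f integrable_on {..a} \<and> f integrable_on {b..}"
    using f by (auto simp: integrable_on_def has_integral_reflect_atMost
        intro: integrable_on_UNIV_imp_atLeast[unfolded integrable_on_def])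
next
  assume *: "f integrable_on {..a} \<and> f integrable_on {b..}"
  have meet: "{a..b} \<inter> {b..} = {b}" "{..a} \<inter> {a..} = {a}"
    and join: "{a..} = {a..b} \<union> {b..}" "UNIV = {..a} \<union> {a..}"
    using \<open>a \<le> b\<close> by auto
  have right: "f integrable_on {a..}"
    using * by (intro integrable_Un'[OF ab _ _ join(1)]) (simp_all only: meet negligible_sing)
  show "f integrable_on UNIV"
    using * right by (intro integrable_Un'[OF _ right _ join(2)]) (simp_all only: meet negligible_sing)
qed

text \<open>
  The tail integral \<open>T\<close> tends to \<open>0\<close>, so for bounded \<open>h\<close> the boundary term \<open>h b * T b\<close> disappears in
  the limit, and the integrals of \<open>h f\<close> and \<open>h' T\<close> over \<open>{a..b}\<close> converge together.
\<close>

lemma integrable_on_atLeast_by_parts: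
  fixes f h h' :: "real \<Rightarrow> real"
  assumes f: "f integrable_on {a..}"
    and h: "\<And>x. a \<le> x \<Longrightarrow> (h has_real_derivative h' x) (at x within {a..})"
    and cont: "continuous_on {a..} h'"
    and bound: "\<And>x. a \<le> x \<Longrightarrow> \<bar>h x\<bar> \<le> M"
  shows "(\<lambda>x. h x * f x) integrable_on {a..} \<longleftrightarrow>
    (\<lambda>x. h' x * integral {x..} f) integrable_on {a..}"
proof -
  define T where "T x = integral {x..} f" for x
  have loc: "f integrable_on {a..b}" for b
    using f by (auto simp: integrable_on_def[of f "{a..}"] has_integral_atLeast_iff)
  have T: "T x = T a - integral {a..x} f" if "a \<le> x" for x
    using has_integral_atLeast_tail[OF f that] by (simp add: T_def integral_unique)
  have "((\<lambda>b. integral {a..b} f) \<longlongrightarrow> T a) at_top"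
    using integrable_integral[OF f] by (simp add: has_integral_atLeast_iff T_def)
  then have "((\<lambda>b. T a - integral {a..b} f) \<longlongrightarrow> T a - T a) at_top"
    by (intro tendsto_intros)
  then have T_lim: "(T \<longlongrightarrow> 0) at_top"
    unfolding diff_self
    by (rule Lim_transform_eventually) (rule eventually_at_top_linorderI[of a], rule T[symmetric])
  have hT: "((\<lambda>b. h b * T b) \<longlongrightarrow> 0) at_top"
  proof (rule Lim_null_comparison)
    have "norm (h b * T b) \<le> M * \<bar>T b\<bar>" if "a \<le> b" for b
      unfolding real_norm_def abs_mult using bound[OF that] by (rule mult_right_mono) simp
    then show "\<forall>\<^sub>F b in at_top. norm (h b * T b) \<le> M * \<bar>T b\<bar>"
      by (rule eventually_at_top_linorderI[of a])
    show "((\<lambda>b. M * \<bar>T b\<bar>) \<longlongrightarrow> 0) at_top"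
      by (intro tendsto_mult_right_zero tendsto_rabs_zero T_lim)
  qed
  have parts: "((\<lambda>x. h x * f x) has_integral (h a * T a - h b * T b + integral {a..b} (\<lambda>x. h' x * T x))) {a..b}"
    if "a \<le> b" for b
  proof -
    have "((\<lambda>x. h x * f x) has_integral
        (h b * - T b - h a * - T a - integral {a..b} (\<lambda>x. h' x * - T x))) {a..b}"
    proof (rule has_integral_by_parts[OF loc that])
      show "- T x = - T a + integral {a..x} f" if "x \<in> {a..b}" for x
        using T[of x] that by simp
      show "(h has_real_derivative h' x) (at x within {a..b})" if "x \<in> {a..b}" for x
        by (rule DERIV_subset[OF h]) (use that in auto)
      show "continuous_on {a..b} h'"
        by (rule continuous_on_subset[OF cont]) auto
    qed
    then show ?thesis by (simp add: algebra_simps)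
  qed
  have int_hf: "(\<lambda>x. h x * f x) integrable_on {a..b}" for b
    using parts[of b] by (cases "a \<le> b") auto
  have int_hT: "(\<lambda>x. h' x * T x) integrable_on {a..b}" for b
  proof -
    have "continuous_on {a..b} T"
      by (subst continuous_on_cong[OF refl T])
        (auto intro!: continuous_intros indefinite_integral_continuous_1 loc)
    then show ?thesis
      by (intro integrable_continuous_interval continuous_intros continuous_on_subset[OF cont]) auto
  qed
  have ev: "\<forall>\<^sub>F b in at_top. integral {a..b} (\<lambda>x. h x * f x) =
      h a * T a - h b * T b + integral {a..b} (\<lambda>x. h' x * T x)"
    using parts by (intro eventually_at_top_linorderI[of a]) (rule integral_unique)
  have "(\<exists>l. ((\<lambda>b. integral {a..b} (\<lambda>x. h x * f x)) \<longlongrightarrow> l) at_top) \<longleftrightarrow>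
    (\<exists>l. ((\<lambda>b. integral {a..b} (\<lambda>x. h' x * T x)) \<longlongrightarrow> l) at_top)"
  proof
    assume "\<exists>l. ((\<lambda>b. integral {a..b} (\<lambda>x. h x * f x)) \<longlongrightarrow> l) at_top"
    then obtain l where l: "((\<lambda>b. integral {a..b} (\<lambda>x. h x * f x)) \<longlongrightarrow> l) at_top" ..
    have "((\<lambda>b. integral {a..b} (\<lambda>x. h x * f x) + h b * T b - h a * T a) \<longlongrightarrow> l + 0 - h a * T a) at_top"
      by (intro tendsto_intros l hT)
    moreover have "\<forall>\<^sub>F b in at_top. integral {a..b} (\<lambda>x. h x * f x) + h b * T b - h a * T a =
        integral {a..b} (\<lambda>x. h' x * T x)"
      using ev by (rule eventually_mono) simp
    ultimately show "\<exists>l. ((\<lambda>b. integral {a..b} (\<lambda>x. h' x * T x)) \<longlongrightarrow> l) at_top"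
      by - (rule exI, erule (1) Lim_transform_eventually)
  next
    assume "\<exists>l. ((\<lambda>b. integral {a..b} (\<lambda>x. h' x * T x)) \<longlongrightarrow> l) at_top"
    then obtain l where l: "((\<lambda>b. integral {a..b} (\<lambda>x. h' x * T x)) \<longlongrightarrow> l) at_top" ..
    have "((\<lambda>b. h a * T a - h b * T b + integral {a..b} (\<lambda>x. h' x * T x)) \<longlongrightarrow> h a * T a - 0 + l) at_top"
      by (intro tendsto_intros l hT)
    moreover have "\<forall>\<^sub>F b in at_top. h a * T a - h b * T b + integral {a..b} (\<lambda>x. h' x * T x) =
        integral {a..b} (\<lambda>x. h x * f x)"
      using ev by (rule eventually_mono) simp
    ultimately show "\<exists>l. ((\<lambda>b. integral {a..b} (\<lambda>x. h x * f x)) \<longlongrightarrow> l) at_top"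
      by - (rule exI, erule (1) Lim_transform_eventually)
  qed
  then show ?thesis
    unfolding integrable_on_def[of _ "{a..}"] has_integral_atLeast_iff T_def[symmetric]
    using int_hf int_hT by simp
qed

section \<open>Dirichlet's test\<close>

text \<open>
  The second mean value theorem bounds the integral of \<open>g f\<close> over \<open>{x..y}\<close> by
  \<open>M (\<bar>g x\<bar> + \<bar>g y\<bar>)\<close>, which gives Cauchy's criterion.
\<close>

lemma Dirichlet_test_integral:
  fixes f g :: "real \<Rightarrow> real"
  assumes f: "\<And>b. f integrable_on {a..b}"
    and M: "\<And>x y. a \<le> x \<Longrightarrow> x \<le> y \<Longrightarrow> \<bar>integral {x..y} f\<bar> \<le> M"
    and g: "\<And>x y. a \<le> x \<Longrightarrow> x \<le> y \<Longrightarrow> g y \<le> g x"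
    and lim: "(g \<longlongrightarrow> 0) at_top"
  shows "(\<lambda>x. g x * f x) integrable_on {a..}"
proof (rule integrable_on_atLeast_Cauchy)
  have sub: "f integrable_on {x..y}" if "a \<le> x" for x y
    using f by (rule integrable_subinterval_real) (use that in auto)
  have smvt: "\<exists>c\<in>{x..y}. ((\<lambda>x. g x * f x) has_integral
      (g x * integral {x..c} f + g y * integral {c..y} f)) {x..y}" if xy: "a \<le> x" "x \<le> y" for x y
  proof -
    obtain c where c: "c \<in> {x..y}" and
      I: "((\<lambda>t. - g t * f t) has_integral (- g x * integral {x..c} f + - g y * integral {c..y} f)) {x..y}"
    proof (rule second_mean_value_theorem_full[OF sub[OF xy(1)] xy(2), of "\<lambda>t. - g t"])
      show "- g u \<le> - g v" if "x \<le> u" "u \<le> v" "v \<le> y" for u v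
        using g[of u v] that xy by simp
    qed
    have "((\<lambda>t. g t * f t) has_integral (g x * integral {x..c} f + g y * integral {c..y} f)) {x..y}"
      using has_integral_neg[OF I] by (simp add: add.commute)
    with c show ?thesis by blast
  qed
  show "(\<lambda>x. g x * f x) integrable_on {a..b}" for b
    using smvt[of a b] by (cases "a \<le> b") (auto simp: integrable_on_def)
  fix e :: real assume "e > 0"
  have "0 \<le> M" using M[of a a] by simp
  define d where "d = e / (2 * M + 1)"
  have "d > 0" using \<open>e > 0\<close> \<open>0 \<le> M\<close> by (simp add: d_def)
  then obtain N where N: "\<And>x. x \<ge> N \<Longrightarrow> \<bar>g x\<bar> < d"
    using tendstoD[OF lim \<open>d > 0\<close>] unfolding eventually_at_top_linorder dist_real_def diff_0_right by blast
  have "\<bar>integral {x..y} (\<lambda>x. g x * f x)\<bar> < e" if xy: "x \<ge> max a N" "y \<ge> x" for x y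
  proof -
    obtain c where c: "c \<in> {x..y}" and
      hI: "((\<lambda>x. g x * f x) has_integral (g x * integral {x..c} f + g y * integral {c..y} f)) {x..y}"
      using smvt[of x y] xy by auto
    have I: "integral {x..y} (\<lambda>x. g x * f x) = g x * integral {x..c} f + g y * integral {c..y} f"
      using hI by (rule integral_unique)
    have "\<bar>g x * integral {x..c} f\<bar> \<le> d * M" "\<bar>g y * integral {c..y} f\<bar> \<le> d * M"
      unfolding abs_mult using N[of x] N[of y] M[of x c] M[of c y] c xy \<open>0 \<le> M\<close>
      by (auto intro!: mult_mono)
    then have "\<bar>integral {x..y} (\<lambda>x. g x * f x)\<bar> \<le> 2 * M * d"
      unfolding I by (simp add: algebra_simps)
    also have "\<dots> < e" using \<open>e > 0\<close> \<open>0 \<le> M\<close> by (simp add: d_def field_simps)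
    finally show ?thesis .
  qed
  then show "\<exists>N. \<forall>x\<ge>N. \<forall>y\<ge>x. norm (integral {x..y} (\<lambda>x. g x * f x)) < e"
    unfolding real_norm_def by (intro exI[of _ "max a N"] allI impI)
qed

text \<open>
  Let \<open>V x\<close> be the total variation of \<open>f\<close> on \<open>{x..}\<close>. Since \<open>V\<close> decreases by at least \<open>\<bar>f y - f x\<bar>\<close>
  from \<open>x\<close> to \<open>y\<close>, both \<open>V + f\<close> and \<open>V - f\<close> are decreasing. They have the same limit \<open>l\<close> as \<open>V\<close>,
  so half of each, shifted by \<open>l\<close>, will do.
\<close>

lemma bounded_variation_on_imp_monotone_difference:
  fixes f :: "real \<Rightarrow> real"
  assumes bv: "bounded_variation_on f {R..}" and lim: "(f \<longlongrightarrow> 0) at_top"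
  obtains g h where "\<And>x y. R \<le> x \<Longrightarrow> x \<le> y \<Longrightarrow> g y \<le> g x" "(g \<longlongrightarrow> 0) at_top"
    and "\<And>x y. R \<le> x \<Longrightarrow> x \<le> y \<Longrightarrow> h y \<le> h x" "(h \<longlongrightarrow> 0) at_top"
    and "\<And>x. f x = g x - h x"
proof -
  define vars where "vars x = {(\<Sum>i<n. \<bar>f (c (Suc i)) - f (c i)\<bar>) |n c.
    (\<forall>i\<le>n. c i \<in> {x..}) \<and> (\<forall>i<n. c i \<le> c (Suc i))}" for x
  define V where "V x = Sup (vars x)" for x
  obtain B where B: "\<And>n c. (\<forall>i\<le>n. c i \<in> {R..}) \<Longrightarrow> (\<forall>i<n. c i \<le> c (Suc i)) \<Longrightarrow>
      (\<Sum>i<n. \<bar>f (c (Suc i)) - f (c i)\<bar>) \<le> B"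
    using bv unfolding bounded_variation_on_def by blast
  \<comment> \<open>the chain with the single point \<open>x\<close>\<close>
  have zero: "0 \<in> vars x" for x
    unfolding vars_def mem_Collect_eq by (rule exI[of _ 0], rule exI[of _ "\<lambda>_. x"]) simp
  have bdd: "bdd_above (vars x)" if "R \<le> x" for x
  proof (rule bdd_aboveI)
    fix v assume "v \<in> vars x"
    then show "v \<le> B" unfolding vars_def using that by (force intro: B)
  qed
  have V_ge: "V y + \<bar>f y - f x\<bar> \<le> V x" if "R \<le> x" "x \<le> y" for x y
  proof -
    have "v \<le> V x - \<bar>f y - f x\<bar>" if "v \<in> vars y" for v
    proof -
      obtain n c where v: "v = (\<Sum>i<n. \<bar>f (c (Suc i)) - f (c i)\<bar>)"
        and c: "\<And>i. i \<le> n \<Longrightarrow> c i \<ge> y" "\<And>i. i < n \<Longrightarrow> c i \<le> c (Suc i)"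
        using \<open>v \<in> vars y\<close> unfolding vars_def mem_Collect_eq atLeast_iff by blast
      \<comment> \<open>prepend the step from \<open>x\<close> to \<open>y\<close> to a chain in \<open>{y..}\<close>\<close>
      define c' where "c' = case_nat x (case_nat y c)"
      have "(\<Sum>i<Suc (Suc n). \<bar>f (c' (Suc i)) - f (c' i)\<bar>) = \<bar>f y - f x\<bar> + (\<bar>f (c 0) - f y\<bar> + v)"
        by (simp add: c'_def v sum.lessThan_Suc_shift del: sum.lessThan_Suc)
      moreover have "(\<Sum>i<Suc (Suc n). \<bar>f (c' (Suc i)) - f (c' i)\<bar>) \<in> vars x"
      proof -
        have "\<forall>i\<le>Suc (Suc n). c' i \<in> {x..}"
          using c(1) \<open>x \<le> y\<close> by (force simp: c'_def split: nat.splits)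
        moreover have "\<forall>i<Suc (Suc n). c' i \<le> c' (Suc i)"
          using c \<open>x \<le> y\<close> by (auto simp: c'_def split: nat.splits)
        ultimately show ?thesis unfolding vars_def by blast
      qed
      ultimately have "\<bar>f y - f x\<bar> + (\<bar>f (c 0) - f y\<bar> + v) \<le> V x"
        unfolding V_def using bdd[OF \<open>R \<le> x\<close>] by (metis cSup_upper)
      then show ?thesis by linarith
    qed
    then have "V y \<le> V x - \<bar>f y - f x\<bar>"
      unfolding V_def[of y] using zero by (intro cSup_least) auto
    then show ?thesis by linarith
  qed
  have V_nonneg: "0 \<le> V x" if "R \<le> x" for x
    unfolding V_def using zero bdd[OF that] by (rule cSup_upper)
  define l where "l = Inf (V ` {R..})"
  have V_lim: "(V \<longlongrightarrow> l) at_top"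
  proof (rule decreasing_tendsto)
    have bddV: "bdd_below (V ` {R..})" using V_nonneg by (intro bdd_belowI2) auto
    show "\<forall>\<^sub>F x in at_top. l \<le> V x"
      unfolding l_def using bddV by (intro eventually_at_top_linorderI[of R] cInf_lower) auto
    fix u assume "l < u"
    then obtain x where x: "R \<le> x" "V x < u"
      unfolding l_def using bddV by (subst (asm) cInf_less_iff) auto
    have "V y < u" if "x \<le> y" for y using V_ge[OF x(1) that] x(2) by linarith
    then show "\<forall>\<^sub>F y in at_top. V y < u" by (rule eventually_at_top_linorderI)
  qed
  show ?thesis
  proof (rule that[of "\<lambda>x. (V x + f x - l) / 2" "\<lambda>x. (V x - f x - l) / 2"])
    have "((\<lambda>x. (V x + f x - l) / 2) \<longlongrightarrow> (l + 0 - l) / 2) at_top"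
      by (intro tendsto_intros V_lim lim) simp
    then show "((\<lambda>x. (V x + f x - l) / 2) \<longlongrightarrow> 0) at_top" by simp
    have "((\<lambda>x. (V x - f x - l) / 2) \<longlongrightarrow> (l - 0 - l) / 2) at_top"
      by (intro tendsto_intros V_lim lim) simp
    then show "((\<lambda>x. (V x - f x - l) / 2) \<longlongrightarrow> 0) at_top" by simp
    fix x y :: real assume "R \<le> x" "x \<le> y"
    from V_ge[OF this] show "(V y + f y - l) / 2 \<le> (V x + f x - l) / 2"
      "(V y - f y - l) / 2 \<le> (V x - f x - l) / 2" by auto
  qed (simp add: field_simps)
qed

lemma Dirichlet_test_bounded_variation:
  fixes f g :: "real \<Rightarrow> real"
  assumes bv: "bounded_variation_on f {R..}" and lim: "(f \<longlongrightarrow> 0) at_top"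
    and g: "\<And>b. g integrable_on {R..b}"
    and M: "\<And>x y. R \<le> x \<Longrightarrow> x \<le> y \<Longrightarrow> \<bar>integral {x..y} g\<bar> \<le> M"
  shows "(\<lambda>x. g x * f x) integrable_on {R..}"
proof -
  obtain p q where p: "\<And>x y. R \<le> x \<Longrightarrow> x \<le> y \<Longrightarrow> p y \<le> p x" "(p \<longlongrightarrow> 0) at_top"
    and q: "\<And>x y. R \<le> x \<Longrightarrow> x \<le> y \<Longrightarrow> q y \<le> q x" "(q \<longlongrightarrow> 0) at_top"
    and f: "\<And>x. f x = p x - q x"
    using bounded_variation_on_imp_monotone_difference[OF bv lim] by blast
  have "(\<lambda>x. p x * g x - q x * g x) integrable_on {R..}"
    by (intro integrable_diff Dirichlet_test_integral[OF g M p] Dirichlet_test_integral[OF g M q])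
  then show ?thesis by (simp add: f algebra_simps)
qed

section \<open>The Fourier kernel\<close>

lemma fourier_integrable_iff:
  "(\<lambda>x. fourier_kernel s x * complex_of_real (g x)) integrable_on S \<longleftrightarrow>
    (\<lambda>x. cos (s * x) * g x) integrable_on S \<and> (\<lambda>x. sin (s * x) * g x) integrable_on S"
proof -
  have kernel: "fourier_kernel s x = cis (- (s * x))" for x
    by (simp add: fourier_kernel_def cis_conv_exp mult.assoc)
  have "(\<lambda>x. fourier_kernel s x * complex_of_real (g x)) integrable_on S \<longleftrightarrow>
    (\<lambda>x. cos (s * x) * g x) integrable_on S \<and> (\<lambda>x. - (sin (s * x) * g x)) integrable_on S"
    by (subst integrable_componentwise_iff) (simp add: Basis_complex_def kernel inner_complex_def)
  then show ?thesis by (simp only: integrable_neg_iff)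
qed

text \<open>
  Reflection turns \<open>s\<close> into \<open>-s\<close>, but integrability of the cosine and sine parts is insensitive to
  the sign of \<open>s\<close>.
\<close>

lemma fourier_integrable_reflect:
  "(\<lambda>x. fourier_kernel s x * complex_of_real (g (- x))) integrable_on {- a..} \<longleftrightarrow>
    (\<lambda>x. fourier_kernel s x * complex_of_real (g x)) integrable_on {..a}"
proof -
  have reflect: "(\<lambda>x. k (- x)) integrable_on {- a..} \<longleftrightarrow> k integrable_on {..a}" for k :: "real \<Rightarrow> real"
    by (simp add: integrable_on_def has_integral_reflect_atMost)
  show ?thesis
    using reflect[of "\<lambda>x. cos (s * x) * g x"] reflect[of "\<lambda>x. sin (s * x) * g x"]
    by (simp add: fourier_integrable_iff integrable_neg_iff)
qed

lemma fourier_integrable_Icc: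
  assumes "f \<in> HK_loc"
  shows "(\<lambda>x. fourier_kernel s x * complex_of_real (f x)) integrable_on {a..b}"
  using assms by (simp add: fourier_integrable_iff integrable_on_mult_cos_sin HK_loc_def)

lemma fourier_exists_at_iff_half_lines:
  assumes f: "f \<in> HK_loc" and "0 \<le> R"
  shows "fourier_exists_at f s \<longleftrightarrow>
    (\<lambda>x. fourier_kernel s x * complex_of_real (f (- x))) integrable_on {R..} \<and>
    (\<lambda>x. fourier_kernel s x * complex_of_real (f x)) integrable_on {R..}"
  using integrable_on_UNIV_iff_tails[OF _ fourier_integrable_Icc[OF f], of "- R" R s] \<open>0 \<le> R\<close>
    fourier_integrable_reflect[of s f "- R"]
  by (simp add: fourier_exists_at_def)

lemma HK_loc_reflect: "f \<in> HK_loc \<Longrightarrow> (\<lambda>x. f (- x)) \<in> HK_loc"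
  unfolding HK_loc_def mem_Collect_eq
  by (metis Henstock_Kurzweil_Integration.integrable_reflect_real minus_minus)

lemma fourier_exists_imp_HK_loc:
  assumes "fourier_exists_at f s"
  shows "f \<in> HK_loc"
proof -
  have "f integrable_on {a..b}" for a b
  proof -
    have c: "(\<lambda>x. cos (s * x) * f x) integrable_on {a..b}" and d: "(\<lambda>x. sin (s * x) * f x) integrable_on {a..b}"
      using assms integrable_on_subinterval[of _ UNIV a b]
      by (auto simp: fourier_exists_at_def fourier_integrable_iff)
    have "(\<lambda>x. cos (s * x) * (cos (s * x) * f x) + sin (s * x) * (sin (s * x) * f x)) integrable_on {a..b}"
      by (intro integrable_add integrable_on_mult_cos_sin c d)
    moreover have "cos (s * x) * (cos (s * x) * f x) + sin (s * x) * (sin (s * x) * f x) = f x" for x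
    proof -
      have "cos (s * x) * (cos (s * x) * f x) + sin (s * x) * (sin (s * x) * f x)
          = ((sin (s * x))\<^sup>2 + (cos (s * x))\<^sup>2) * f x"
        unfolding power2_eq_square by algebra
      also have "\<dots> = f x" unfolding sin_cos_squared_add by simp
      finally show ?thesis .
    qed
    ultimately show ?thesis by simp
  qed
  then show ?thesis by (simp add: HK_loc_def)
qed

lemma fourier_integrable_atLeast_if_abs:
  assumes f: "f \<in> HK_loc" and abs: "(\<lambda>x. \<bar>f x\<bar>) integrable_on {R..}"
  shows "(\<lambda>x. fourier_kernel s x * complex_of_real (f x)) integrable_on {R..}"
proof (rule integrable_on_all_intervals_integrable_bound[OF _ _ abs])
  show "(\<lambda>x. if x \<in> {R..} then fourier_kernel s x * complex_of_real (f x) else 0) integrable_on cbox a b" for a b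
    unfolding box_real integrable_atLeast_restrict_iff by (rule fourier_integrable_Icc[OF f])
  show "norm (fourier_kernel s x * complex_of_real (f x)) \<le> \<bar>f x\<bar>" for x
    by (simp add: norm_mult fourier_kernel_def)
qed

text \<open>
  A chain in \<open>{R..}\<close>, negated and read backwards, is a chain in \<open>{..- R}\<close> with the same variation.
\<close>

lemma bounded_variation_on_reflect:
  assumes "bounded_variation_on f {..- R}"
  shows "bounded_variation_on (\<lambda>x. f (- x)) {R..}"
proof -
  obtain B where B: "\<And>n x. (\<forall>i\<le>n. x i \<in> {..- R}) \<Longrightarrow> (\<forall>i<n. x i \<le> x (Suc i)) \<Longrightarrow>
      (\<Sum>i<n. \<bar>f (x (Suc i)) - f (x i)\<bar>) \<le> B"
    using assms unfolding bounded_variation_on_def by blast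
  have "(\<Sum>i<n. \<bar>f (- x (Suc i)) - f (- x i)\<bar>) \<le> B"
    if x: "\<forall>i\<le>n. x i \<in> {R..}" "\<forall>i<n. x i \<le> x (Suc i)" for n and x :: "nat \<Rightarrow> real"
  proof -
    define y where "y i = - x (n - i)" for i
    have "(\<Sum>i<n. \<bar>f (- x (Suc i)) - f (- x i)\<bar>) =
        (\<Sum>i<n. \<bar>f (- x (Suc (n - Suc i))) - f (- x (n - Suc i))\<bar>)"
      by (rule sum.nat_diff_reindex[symmetric])
    also have "\<dots> = (\<Sum>i<n. \<bar>f (y (Suc i)) - f (y i)\<bar>)"
      by (rule sum.cong) (simp_all add: y_def Suc_diff_Suc abs_minus_commute)
    also have "\<dots> \<le> B"
    proof (rule B)
      show "\<forall>i\<le>n. y i \<in> {..- R}" using x(1) by (simp add: y_def)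
      have "x (n - Suc i) \<le> x (Suc (n - Suc i))" if "i < n" for i
        using x(2) that by simp
      then show "\<forall>i<n. y i \<le> y (Suc i)" by (simp add: y_def Suc_diff_Suc)
    qed
    finally show ?thesis .
  qed
  then show ?thesis unfolding bounded_variation_on_def by blast
qed

lemma fourier_integrable_atLeast_if_bounded_variation:
  assumes bv: "bounded_variation_on f {R..}" and lim: "(f \<longlongrightarrow> 0) at_top" and "s \<noteq> 0"
  shows "(\<lambda>x. fourier_kernel s x * complex_of_real (f x)) integrable_on {R..}"
proof -
  have c: "((\<lambda>x. cos (s * x)) has_integral (sin (s * y) / s - sin (s * x) / s)) {x..y}" if "x \<le> y" for x y
    using that \<open>s \<noteq> 0\<close> by (intro fundamental_theorem_of_calculus)
      (auto simp: has_real_derivative_iff_has_vector_derivative[symmetric] intro!: derivative_eq_intros)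
  have d: "((\<lambda>x. sin (s * x)) has_integral (- cos (s * y) / s - - cos (s * x) / s)) {x..y}" if "x \<le> y" for x y
    using that \<open>s \<noteq> 0\<close> by (intro fundamental_theorem_of_calculus)
      (auto simp: has_real_derivative_iff_has_vector_derivative[symmetric] intro!: derivative_eq_intros)
  have small: "\<bar>u / s - v / s\<bar> \<le> 2 / \<bar>s\<bar>" if "\<bar>u\<bar> \<le> 1" "\<bar>v\<bar> \<le> 1" for u v
  proof -
    have "\<bar>u / s - v / s\<bar> = \<bar>u - v\<bar> / \<bar>s\<bar>" by (simp add: diff_divide_distrib[symmetric])
    also have "\<dots> \<le> 2 / \<bar>s\<bar>" using that by (intro divide_right_mono) auto
    finally show ?thesis .
  qed
  have "(\<lambda>x. cos (s * x) * f x) integrable_on {R..}"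
  proof (rule Dirichlet_test_bounded_variation[OF bv lim])
    show "(\<lambda>x. cos (s * x)) integrable_on {R..b}" for b
      by (intro integrable_continuous_interval continuous_intros)
    show "\<bar>integral {x..y} (\<lambda>x. cos (s * x))\<bar> \<le> 2 / \<bar>s\<bar>" if "x \<le> y" for x y
      unfolding integral_unique[OF c[OF that]] by (rule small) simp_all
  qed
  moreover have "(\<lambda>x. sin (s * x) * f x) integrable_on {R..}"
  proof (rule Dirichlet_test_bounded_variation[OF bv lim])
    show "(\<lambda>x. sin (s * x)) integrable_on {R..b}" for b
      by (intro integrable_continuous_interval continuous_intros)
    show "\<bar>integral {x..y} (\<lambda>x. sin (s * x))\<bar> \<le> 2 / \<bar>s\<bar>" if "x \<le> y" for x y
      unfolding integral_unique[OF d[OF that]] by (rule small) simp_all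
  qed
  ultimately show ?thesis by (simp add: fourier_integrable_iff)
qed

text \<open>
  Differentiation exchanges cosine and sine up to the factor \<open>\<plusminus>s\<close>, which can be cancelled because
  it is not \<open>0\<close>. So the cosine part of \<open>f\<close> is matched with the sine part of the tail, and
  vice versa.
\<close>

lemma fourier_integrable_atLeast_iff_right_tail:
  assumes f: "f integrable_on {a..}" and "s \<noteq> 0"
  shows "(\<lambda>x. fourier_kernel s x * complex_of_real (f x)) integrable_on {a..} \<longleftrightarrow>
    (\<lambda>x. fourier_kernel s x * complex_of_real (right_tail f x)) integrable_on {a..}"
proof -
  have "(\<lambda>x. cos (s * x) * f x) integrable_on {a..} \<longleftrightarrow>
      (\<lambda>x. (- s * sin (s * x)) * integral {x..} f) integrable_on {a..}"
    by (rule integrable_on_atLeast_by_parts[OF f, of _ _ 1])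
      (auto intro!: derivative_eq_intros continuous_intros)
  also have "\<dots> \<longleftrightarrow> (\<lambda>x. sin (s * x) * right_tail f x) integrable_on {a..}"
    using integrable_on_cmult_iff[of "- s" "\<lambda>x. sin (s * x) * right_tail f x"] \<open>s \<noteq> 0\<close>
    by (simp add: right_tail_def mult.assoc)
  finally have c: "(\<lambda>x. cos (s * x) * f x) integrable_on {a..} \<longleftrightarrow>
    (\<lambda>x. sin (s * x) * right_tail f x) integrable_on {a..}" .
  have "(\<lambda>x. sin (s * x) * f x) integrable_on {a..} \<longleftrightarrow>
      (\<lambda>x. (s * cos (s * x)) * integral {x..} f) integrable_on {a..}"
    by (rule integrable_on_atLeast_by_parts[OF f, of _ _ 1])
      (auto intro!: derivative_eq_intros continuous_intros)
  also have "\<dots> \<longleftrightarrow> (\<lambda>x. cos (s * x) * right_tail f x) integrable_on {a..}"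
    using integrable_on_cmult_iff[of s "\<lambda>x. cos (s * x) * right_tail f x"] \<open>s \<noteq> 0\<close>
    by (simp add: right_tail_def mult.assoc)
  finally show ?thesis using c by (auto simp: fourier_integrable_iff)
qed

lemma right_tail_reflect: "right_tail (\<lambda>x. f (- x)) x = left_tail f (- x)"
  using has_integral_reflect_atMost[of f _ "- x"]
  by (simp add: right_tail_def left_tail_def integral_def integrable_on_def)

lemma HK_imp_HK_loc: "f \<in> HK \<Longrightarrow> f \<in> HK_loc"
  using integrable_on_subinterval[of f UNIV] by (simp add: HK_def HK_loc_def)

lemma fourier_exists_at_iff_tail_transforms:
  assumes f: "f \<in> HK" and "s \<noteq> 0"
  shows "fourier_exists_at f s \<longleftrightarrow> tail_transforms_exist_at f s"
proof -
  have "(\<lambda>x. f (- x)) integrable_on UNIV"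
    using f has_integral_reflect_UNIV by (auto simp: HK_def integrable_on_def)
  then have left: "(\<lambda>x. f (- x)) integrable_on {0..}"
    by (rule integrable_on_UNIV_imp_atLeast)
  have right: "f integrable_on {0..}"
    using f by (auto simp: HK_def intro: integrable_on_UNIV_imp_atLeast)
  show ?thesis
    using fourier_exists_at_iff_half_lines[OF HK_imp_HK_loc[OF f], of 0 s]
      fourier_integrable_atLeast_iff_right_tail[OF left \<open>s \<noteq> 0\<close>]
      fourier_integrable_atLeast_iff_right_tail[OF right \<open>s \<noteq> 0\<close>]
      fourier_integrable_reflect[of s "left_tail f" 0]
    by (auto simp: tail_transforms_exist_at_def right_tail_reflect)
qed

theorem proposition2:
  fixes f :: "real \<Rightarrow> real"
  shows "((\<exists>s. fourier_exists_at f s) \<longrightarrow> f \<in> HK_loc)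
    \<and> (f \<in> HK_loc \<longrightarrow>
         (abs_integrable_near_infinity f \<longrightarrow> (\<forall>s. fourier_exists_at f s)) \<and>
         (bounded_variation_near_infinity f \<and> (f \<longlongrightarrow> 0) at_top \<and> (f \<longlongrightarrow> 0) at_bot \<longrightarrow>
            (\<forall>s. s \<noteq> 0 \<longrightarrow> fourier_exists_at f s)))
    \<and> (f \<in> HK \<longrightarrow>
         (\<forall>s. s \<noteq> 0 \<longrightarrow> (fourier_exists_at f s \<longleftrightarrow> tail_transforms_exist_at f s)) \<and>
         (tail_transforms_exist_at f 0 \<longrightarrow> fourier_exists_at f 0))"
proof (intro conjI impI allI)
  show "f \<in> HK_loc" if "\<exists>s. fourier_exists_at f s"
    using that fourier_exists_imp_HK_loc by blast
next
  fix s assume f: "f \<in> HK_loc" and "abs_integrable_near_infinity f"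
  then obtain R where "R > 0" and l: "(\<lambda>x. \<bar>f x\<bar>) integrable_on {..- R}"
    and r: "(\<lambda>x. \<bar>f x\<bar>) integrable_on {R..}"
    unfolding abs_integrable_near_infinity_def by blast
  have l': "(\<lambda>x. \<bar>f (- x)\<bar>) integrable_on {R..}"
    using l has_integral_reflect_atMost[of "\<lambda>x. \<bar>f x\<bar>" _ "- R"] by (simp add: integrable_on_def)
  show "fourier_exists_at f s"
    unfolding fourier_exists_at_iff_half_lines[OF f less_imp_le[OF \<open>R > 0\<close>]]
    using fourier_integrable_atLeast_if_abs[OF HK_loc_reflect[OF f] l']
      fourier_integrable_atLeast_if_abs[OF f r] by blast
next
  fix s :: real
  assume f: "f \<in> HK_loc" and "s \<noteq> 0"
    and *: "bounded_variation_near_infinity f \<and> (f \<longlongrightarrow> 0) at_top \<and> (f \<longlongrightarrow> 0) at_bot"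
  then obtain R where "R > 0" and l: "bounded_variation_on f {..- R}"
    and r: "bounded_variation_on f {R..}"
    unfolding bounded_variation_near_infinity_def by blast
  have lim: "((\<lambda>x. f (- x)) \<longlongrightarrow> 0) at_top"
    using * by (simp add: filterlim_at_bot_mirror)
  show "fourier_exists_at f s"
    unfolding fourier_exists_at_iff_half_lines[OF f less_imp_le[OF \<open>R > 0\<close>]]
    using fourier_integrable_atLeast_if_bounded_variation[OF bounded_variation_on_reflect[OF l] lim \<open>s \<noteq> 0\<close>]
      fourier_integrable_atLeast_if_bounded_variation[OF r _ \<open>s \<noteq> 0\<close>] * by blast
next
  show "fourier_exists_at f s \<longleftrightarrow> tail_transforms_exist_at f s" if "f \<in> HK" "s \<noteq> 0" for s
    using that by (rule fourier_exists_at_iff_tail_transforms)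
next
  show "fourier_exists_at f 0" if "f \<in> HK"
    using that by (simp add: fourier_exists_at_def fourier_integrable_iff HK_def integrable_0)
qed

end
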